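(* Let $\rho$ be the unique root in $(0,1)$ of $X^3-4X^2+X+1$, and let $\sigma=(1-\rho)/\rho^4$. Let $\alpha=\eta_1-\eta_2$, $\beta=\eta_0-\eta_2$, $\gamma=\eta_1-\eta_0$, where the $\eta_j$ are the cubic Gaussian periods modulo $13$ defined in the context. Then $$\rho=\frac{\beta}{\alpha},\qquad 1-\rho=\frac{\gamma}{\alpha},\qquad \sigma=\frac{\gamma\alpha^3}{\beta^4}.$$ Equivalently, in terms of the entries $S_{ij}$ of the matrix $$S_{13}=\frac1{\sqrt{13}}\begin{pmatrix}\gamma&\beta\\\alpha&-\gamma\end{pmatrix},$$ one has $$\rho=\frac{S_{12}}{S_{21}},\qquad \sigma=\frac{S_{11}S_{21}^3}{S_{12}^4}.$$
   Context: $\zeta=e^{2\pi i/13}$; $C_0=\{\pm1,\pm5\}$, $C_1=\{\pm2,\pm3\}$, $C_2=\{\pm4,\pm6\}$ are the cubic residues modulo $13$ and their two cosets; $\eta_j=\sum_{a\in C_j}\zeta^a$ for $j=0,1,2$. *)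

theory Defs
  imports "HOL-Analysis.Analysis"
begin

definition zeta13 :: complex where
  "zeta13 = exp (2 * of_real pi * \<i> / 13)"

(* integer representatives of the nonzero cubes modulo 13 and of the cosets 2 C0, 4 C0 *)
definition C0 :: "int set" where "C0 = {1, -1, 5, -5}"
definition C1 :: "int set" where "C1 = {2, -2, 3, -3}"
definition C2 :: "int set" where "C2 = {4, -4, 6, -6}"

definition gauss_period :: "int set \<Rightarrow> complex" where
  "gauss_period C = (\<Sum>a\<in>C. zeta13 powi a)"

definition eta0 :: complex where "eta0 = gauss_period C0"
definition eta1 :: complex where "eta1 = gauss_period C1"
definition eta2 :: complex where "eta2 = gauss_period C2"

definition alpha13 :: complex where "alpha13 = eta1 - eta2"
definition beta13 :: complex where "beta13 = eta0 - eta2"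
definition gamma13 :: complex where "gamma13 = eta1 - eta0"

definition is_rho13 :: "real \<Rightarrow> bool" where
  "is_rho13 x \<longleftrightarrow> x \<in> {0<..<1} \<and> x ^ 3 - 4 * x ^ 2 + x + 1 = 0"

(* unique existence is not presupposed: it has to be asserted where rho13 is used *)
definition rho13 :: real where "rho13 = (THE x. is_rho13 x)"

definition sigma13 :: real where "sigma13 = (1 - rho13) / rho13 ^ 4"

definition S13 :: "complex ^ 2 ^ 2" where
  "S13 = (1 / sqrt 13) *\<^sub>R
     vector [vector [gamma13, beta13],
             vector [alpha13, - gamma13]]"

end

theory Submission
  imports Defs
begin

text \<open>
  The three periods multiply in a very simple way: the Galois automorphism
  \<open>\<zeta> \<mapsto> \<zeta>\<^sup>2\<close> permutes them cyclically, and
  \<open>\<eta>\<^sub>0 \<eta>\<^sub>1 = \<eta>\<^sub>1 - 1\<close>, together with its two conjugates and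
  \<open>\<eta>\<^sub>0 + \<eta>\<^sub>1 + \<eta>\<^sub>2 = -1\<close>, determines the whole cubic ring.  From these relations
  one reads off \<open>\<beta> = (1 - \<eta>\<^sub>0) \<alpha>\<close>, so the quotient \<open>\<beta> / \<alpha>\<close> is the
  integral element \<open>1 - \<eta>\<^sub>0\<close>, and that this element is a root of
  \<open>X\<^sup>3 - 4 X\<^sup>2 + X + 1\<close>.  The quotients make sense because
  \<open>\<alpha> \<beta> \<gamma> = 13\<close>, the square root of the discriminant of the cubic field.

  Everything else is a matter of locating roots.  Writing \<open>\<eta>\<^sub>0\<close> as
  \<open>4 cos (6\<pi>/13) cos (4\<pi>/13)\<close> shows that it lies in \<open>(0,1)\<close>, hence so does
  \<open>1 - \<eta>\<^sub>0\<close>; and a second root in \<open>(0,1)\<close> is excluded by the product of the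
  three roots, which is negative while their sum is 4.  So \<open>\<rho> = 1 - \<eta>\<^sub>0\<close>.  The formula for
  \<open>\<sigma>\<close> follows by substitution, and the matrix versions because all quotients are
  homogeneous of degree zero in \<open>(\<alpha>, \<beta>, \<gamma>)\<close>, so that the scalar \<open>1/\<surd>13\<close> cancels.
\<close>

lemma zeta13_eq_cis: "zeta13 = cis (2 * pi / 13)"
  by (simp add: zeta13_def cis_conv_exp mult_ac)

lemma zeta13_pow_13: "zeta13 ^ 13 = 1"
  unfolding zeta13_eq_cis by (subst Complex.DeMoivre) simp

lemma zeta13_neq_1: "zeta13 \<noteq> 1"
proof
  assume "zeta13 = 1"
  then have "cos (2 * pi / 13) = 1"
    by (simp add: zeta13_eq_cis complex_eq_iff)
  moreover have "cos (2 * pi / 13) < cos 0"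
    by (rule cos_monotone_0_pi) auto
  ultimately show False by simp
qed

lemma zeta13_cyclotomic: "(\<Sum>k<13. zeta13 ^ k) = 0"
  using geometric_sum[OF zeta13_neq_1, of 13] zeta13_pow_13 by simp

lemma zeta13_powi_minus:
  assumes "k \<le> 13"
  shows "zeta13 powi (- int k) = zeta13 ^ (13 - k)"
proof -
  have "zeta13 ^ (13 - k) * zeta13 ^ k = 1"
    using assms by (simp add: zeta13_pow_13 flip: power_add)
  then show ?thesis
    by (simp add: power_int_minus inverse_unique mult.commute)
qed

lemma eta_as_polynomials:
  "eta0 = zeta13 + zeta13 ^ 12 + zeta13 ^ 5 + zeta13 ^ 8"
  "eta1 = zeta13 ^ 2 + zeta13 ^ 11 + zeta13 ^ 3 + zeta13 ^ 10"
  "eta2 = zeta13 ^ 4 + zeta13 ^ 9 + zeta13 ^ 6 + zeta13 ^ 7"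
  using zeta13_powi_minus[of 1] zeta13_powi_minus[of 2] zeta13_powi_minus[of 3]
    zeta13_powi_minus[of 4] zeta13_powi_minus[of 5] zeta13_powi_minus[of 6]
  by (simp_all add: eta0_def eta1_def eta2_def gauss_period_def C0_def C1_def C2_def)

lemma sum_eta: "eta0 + eta1 + eta2 = -1"
proof -
  have "1 + (eta0 + eta1 + eta2) = (\<Sum>k<13. zeta13 ^ k)"
    by (simp add: eta_as_polynomials eval_nat_numeral)
  then show ?thesis
    using zeta13_cyclotomic by (simp add: add_eq_0_iff)
qed

text \<open>
  Each product expands into sixteen powers of \<open>\<zeta>\<close>; reduced by \<open>\<zeta>^13 = 1\<close>, every
  element of \<open>C\<^sub>1\<close> occurs twice and every element of \<open>C\<^sub>0\<close> and \<open>C\<^sub>2\<close> once in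
  \<open>\<eta>\<^sub>0 \<eta>\<^sub>1\<close>.  Multiplying the index sets by 2 and by 4 gives the other two.
\<close>
lemma eta_products:
  "eta0 * eta1 = eta1 - 1"
  "eta1 * eta2 = eta2 - 1"
  "eta2 * eta0 = eta0 - 1"
proof -
  have red: "zeta13 ^ (13 + k) = zeta13 ^ k" for k
    by (simp add: power_add zeta13_pow_13)
  note red' = red[of 0, simplified] red[of 1, simplified] red[of 2, simplified]
    red[of 3, simplified] red[of 4, simplified] red[of 5, simplified]
    red[of 6, simplified] red[of 7, simplified] red[of 8, simplified]
    red[of 9, simplified] red[of 10, simplified]
  note expand = eta_as_polynomials distrib_left distrib_right
    power_add[symmetric] power_Suc[symmetric] power_Suc2[symmetric] red'
  have "eta0 * eta1 = (eta0 + eta1 + eta2) + eta1" by (simp add: expand)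
  then show "eta0 * eta1 = eta1 - 1" by (simp add: sum_eta)
  have "eta1 * eta2 = (eta0 + eta1 + eta2) + eta2" by (simp add: expand)
  then show "eta1 * eta2 = eta2 - 1" by (simp add: sum_eta)
  have "eta2 * eta0 = (eta0 + eta1 + eta2) + eta0" by (simp add: expand)
  then show "eta2 * eta0 = eta0 - 1" by (simp add: sum_eta)
qed

lemma alpha_beta_gamma: "alpha13 * beta13 * gamma13 = 13"
  unfolding alpha13_def beta13_def gamma13_def
  using eta_products sum_eta by algebra

lemma beta_eq: "beta13 = (1 - eta0) * alpha13"
  unfolding alpha13_def beta13_def using eta_products by algebra

lemma gamma_eq: "gamma13 = eta0 * alpha13"
  unfolding alpha13_def gamma13_def using eta_products by algebra

lemma cubic_one_minus_eta0: "(1 - eta0) ^ 3 - 4 * (1 - eta0) ^ 2 + (1 - eta0) + 1 = 0"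
  using eta_products sum_eta by algebra

text \<open>
  Pairing \<open>\<zeta>\<^sup>a\<close> with \<open>\<zeta>\<^sup>-\<^sup>a\<close> gives \<open>\<eta>\<^sub>0 = 2 cos (2\<pi>/13) + 2 cos (10\<pi>/13)\<close>.  In the
  product form below the factor \<open>cos (6\<pi>/13) = sin (\<pi>/26)\<close> is less than \<open>1/4\<close>.
\<close>
lemma eta0_real:
  "eta0 = complex_of_real (4 * cos (6 * pi / 13) * cos (4 * pi / 13))"
proof -
  have "eta0 = complex_of_real (2 * cos (2 * pi / 13) + 2 * cos (10 * pi / 13))"
    by (simp add: eta0_def gauss_period_def C0_def zeta13_eq_cis cis_power_int complex_eq_iff)
  also have "2 * cos (2 * pi / 13) + 2 * cos (10 * pi / 13)
      = 4 * cos (6 * pi / 13) * cos (4 * pi / 13)"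
    using cos_plus_cos[of "2 * pi / 13" "10 * pi / 13"] cos_minus[of "4 * pi / 13"]
    by (simp add: field_simps)
  finally show ?thesis .
qed

lemma eta0_bounds:
  "4 * cos (6 * pi / 13) * cos (4 * pi / 13) \<in> {0<..<1}"
proof -
  have pos6: "0 < cos (6 * pi / 13)" and pos4: "0 < cos (4 * pi / 13)"
    by (rule cos_gt_zero; simp)+
  have "cos (6 * pi / 13) = sin (pi / 26)"
    using cos_sin_eq[of "6 * pi / 13"] by (simp add: field_simps)
  also have "\<dots> \<le> pi / 26"
    by (rule sin_x_le_x) simp
  also have "\<dots> < 1 / 4"
    using pi_less_4 by simp
  finally have "cos (6 * pi / 13) < 1 / 4" .
  moreover have "cos (6 * pi / 13) * cos (4 * pi / 13) \<le> cos (6 * pi / 13)"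
    using pos6 by (simp add: mult_left_le)
  ultimately have "4 * cos (6 * pi / 13) * cos (4 * pi / 13) < 1"
    by linarith
  then show ?thesis
    using pos6 pos4 by simp
qed

text \<open>
  If \<open>x\<close> and \<open>y\<close> were distinct roots in \<open>(0,1)\<close>, the third root would be
  \<open>4 - x - y > 0\<close>, whereas the product of the three roots is \<open>-1\<close>.
\<close>
lemma is_rho13_unique:
  assumes "is_rho13 x" "is_rho13 y"
  shows "x = y"
proof (rule ccontr)
  assume "x \<noteq> y"
  have x: "0 < x" "x < 1" "x ^ 3 - 4 * x ^ 2 + x + 1 = 0"
    and y: "0 < y" "y < 1" "y ^ 3 - 4 * y ^ 2 + y + 1 = 0"
    using assms by (auto simp: is_rho13_def)
  have "(x - y) * (x ^ 2 + x * y + y ^ 2 - 4 * (x + y) + 1) = 0"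
    using x(3) y(3) by algebra
  with \<open>x \<noteq> y\<close> have "x ^ 2 + x * y + y ^ 2 - 4 * (x + y) + 1 = 0"
    by simp
  then have "x * y * (4 - x - y) = -1"
    using x(3) by algebra
  moreover have "0 < x * y * (4 - x - y)"
    using x y by simp
  ultimately show False by simp
qed

theorem mainTheorem8:
  shows "(\<exists>!x. is_rho13 x) \<and>
    complex_of_real rho13 = beta13 / alpha13 \<and>
    complex_of_real (1 - rho13) = gamma13 / alpha13 \<and>
    complex_of_real sigma13 = gamma13 * alpha13 ^ 3 / beta13 ^ 4 \<and>
    complex_of_real rho13 = S13 $ 1 $ 2 / S13 $ 2 $ 1 \<and>
    complex_of_real sigma13 = S13 $ 1 $ 1 * (S13 $ 2 $ 1) ^ 3 / (S13 $ 1 $ 2) ^ 4"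
proof -
  define e where "e = 4 * cos (6 * pi / 13) * cos (4 * pi / 13)"
  have e: "eta0 = complex_of_real e"
    unfolding e_def by (rule eta0_real)
  have "complex_of_real ((1 - e) ^ 3 - 4 * (1 - e) ^ 2 + (1 - e) + 1) = 0"
    using cubic_one_minus_eta0 by (simp add: e)
  then have "(1 - e) ^ 3 - 4 * (1 - e) ^ 2 + (1 - e) + 1 = 0"
    by (simp only: of_real_eq_0_iff)
  then have root: "is_rho13 (1 - e)"
    using eta0_bounds by (simp add: is_rho13_def e_def)
  then have ex1: "\<exists>!x. is_rho13 x"
    using is_rho13_unique by blast
  have rho: "rho13 = 1 - e"
    unfolding rho13_def using root is_rho13_unique by blast
  have nz: "alpha13 \<noteq> 0" "beta13 \<noteq> 0"
    using alpha_beta_gamma by auto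
  have r: "complex_of_real rho13 = beta13 / alpha13"
    using nz(1) by (simp add: rho e beta_eq)
  have r': "complex_of_real (1 - rho13) = gamma13 / alpha13"
    using nz(1) by (simp add: rho e gamma_eq)
  have "complex_of_real sigma13 = complex_of_real (1 - rho13) / complex_of_real rho13 ^ 4"
    by (simp add: sigma13_def)
  also have "\<dots> = gamma13 * alpha13 ^ 3 / beta13 ^ 4"
    using nz unfolding r r' by (simp add: field_simps eval_nat_numeral)
  finally have s: "complex_of_real sigma13 = gamma13 * alpha13 ^ 3 / beta13 ^ 4" .
  define c where "c = complex_of_real (1 / sqrt 13)"
  have c: "c \<noteq> 0"
    by (simp add: c_def)
  have S: "S13 $ 1 $ 1 = c * gamma13" "S13 $ 1 $ 2 = c * beta13" "S13 $ 2 $ 1 = c * alpha13"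
    unfolding S13_def c_def vector_scaleR_component vector_2
    by (simp_all only: scaleR_conv_of_real)
  have "complex_of_real rho13 = S13 $ 1 $ 2 / S13 $ 2 $ 1"
    using c by (simp add: r S)
  moreover have "complex_of_real sigma13 = S13 $ 1 $ 1 * (S13 $ 2 $ 1) ^ 3 / (S13 $ 1 $ 2) ^ 4"
    using c nz by (simp add: s S field_simps eval_nat_numeral)
  ultimately show ?thesis
    using ex1 r r' s by blast
qed

end
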